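(* Let $n\in\mathbb P$, let $\mathbf a\in\mathbb{P}^n$, and let $f=\{f_{\mathbf b}\}_{\mathbf b\le\mathbf a}$ be an array of integers. The following are equivalent: (i) $f$ is the fine $f$-vector of an $\mathbf a$-colored complex. (ii) $f$ is the fine $f$-vector of a color-compressed $\mathbf a$-colored complex.
   Context: $\mathbb N=\{0,1,\dots\}$, $\mathbb P=\{1,2,\dots\}$. Indices $\mathbf b$ range over $\mathbf b\in\mathbb N^n$ with $\mathbf b\le\mathbf a$ componentwise. A simplicial complex $\Delta$ on a finite non-empty vertex set $V$ is a collection of subsets of $V$ (faces) closed under taking subsets with $\{v\}\in\Delta$ for all $v\in V$. An $\mathbf a$-colored complex is a pair $(\Delta,\rho)$ with $\rho=(V_1,\dots,V_n)$ an ordered partition of $V$ into non-empty sets such that $|F\cap V_i|\le a_i$ for every face $F$ and every $i$. Its fine $f$-vector is $\{f_{\mathbf b}\}_{\mathbf b\le\mathbf a}$ where $f_{\mathbf b}$ is the number of faces $F$ with $|F\cap V_i|=b_i$ for all $i$. For a linearly ordered set $S$ and $k\in\mathbb N$, $\binom Sk$ is the set of $k$-subsets of $S$, with the colex order: for $A\neq B$, $A<_{c\ell}B$ iff $\max(A\setminus B)<\max(B\setminus A)$. With each $V_i$ linearly ordered, $(\Delta,\rho)$ is color-compressed if for all $F\in\Delta$ and $t\in\{1,\dots,n\}$ the set $\{F'\cap V_t:F'\in\Delta,\ |F'\cap V_t|=|F\cap V_t|,\ F'\cap(V\setminus V_t)=F\cap(V\setminus V_t)\}$ is a colex initial segment of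 $\binom{V_t}{|F\cap V_t|}$. *)

theory Defs
  imports "HOL-Library.FuncSet" "HOL-Library.Disjoint_Sets" "HOL-Library.Ramsey"
    "HOL-Library.Infinite_Typeclass"
begin

definition simplicial_complex :: "'v set \<Rightarrow> 'v set set \<Rightarrow> bool" where
  "simplicial_complex V \<Delta> \<longleftrightarrow>
     finite V \<and> V \<noteq> {} \<and> \<Delta> \<subseteq> Pow V \<and>
     (\<forall>F\<in>\<Delta>. \<forall>G. G \<subseteq> F \<longrightarrow> G \<in> \<Delta>) \<and>
     (\<forall>v\<in>V. {v} \<in> \<Delta>)"

(* n-tuples are functions on nat, of which only the values at 1, ..., n matter. *)
definition ordered_partition :: "nat \<Rightarrow> 'v set \<Rightarrow> (nat \<Rightarrow> 'v set) \<Rightarrow> bool" where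
  "ordered_partition n V \<rho> \<longleftrightarrow>
     (\<Union>i\<in>{1..n}. \<rho> i) = V \<and> disjoint_family_on \<rho> {1..n} \<and> (\<forall>i\<in>{1..n}. \<rho> i \<noteq> {})"

definition colored_complex ::
    "nat \<Rightarrow> (nat \<Rightarrow> nat) \<Rightarrow> 'v set \<Rightarrow> 'v set set \<Rightarrow> (nat \<Rightarrow> 'v set) \<Rightarrow> bool" where
  "colored_complex n a V \<Delta> \<rho> \<longleftrightarrow>
     simplicial_complex V \<Delta> \<and> ordered_partition n V \<rho> \<and>
     (\<forall>F\<in>\<Delta>. \<forall>i\<in>{1..n}. card (F \<inter> \<rho> i) \<le> a i)"

(* The multi-indices b \<le> a; the extensional product makes them determined by b 1, ..., b n. *)
definition multi_indices :: "nat \<Rightarrow> (nat \<Rightarrow> nat) \<Rightarrow> (nat \<Rightarrow> nat) set" where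
  "multi_indices n a = (\<Pi>\<^sub>E i\<in>{1..n}. {0..a i})"

(* The entries of the array f are its values on multi_indices n a. *)
definition is_fine_f_vector ::
    "nat \<Rightarrow> (nat \<Rightarrow> nat) \<Rightarrow> 'v set set \<Rightarrow> (nat \<Rightarrow> 'v set) \<Rightarrow> ((nat \<Rightarrow> nat) \<Rightarrow> int) \<Rightarrow> bool" where
  "is_fine_f_vector n a \<Delta> \<rho> f \<longleftrightarrow>
     (\<forall>b\<in>multi_indices n a. f b = int (card {F\<in>\<Delta>. \<forall>i\<in>{1..n}. card (F \<inter> \<rho> i) = b i}))"

(* A linear order is a reflexive relation r, with (x, y) \<in> r meaning x \<le> y. *)
definition max_wrt :: "'v rel \<Rightarrow> 'v set \<Rightarrow> 'v" where
  "max_wrt r A = (THE x. x \<in> A \<and> (\<forall>y\<in>A. (y, x) \<in> r))"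

(* Meaningful for finite A and B of equal cardinality: if A \<noteq> B, both differences are
   then non-empty, so that their maxima exist. *)
definition colex_less :: "'v rel \<Rightarrow> 'v set \<Rightarrow> 'v set \<Rightarrow> bool" where
  "colex_less r A B \<longleftrightarrow> A \<noteq> B \<and> (max_wrt r (A - B), max_wrt r (B - A)) \<in> r - Id"

definition colex_initial_segment :: "'v rel \<Rightarrow> 'v set \<Rightarrow> nat \<Rightarrow> 'v set set \<Rightarrow> bool" where
  "colex_initial_segment r S k \<A> \<longleftrightarrow>
     \<A> \<subseteq> [S]\<^bsup>k\<^esup> \<and> (\<forall>B\<in>\<A>. \<forall>A\<in>[S]\<^bsup>k\<^esup>. colex_less r A B \<longrightarrow> A \<in> \<A>)"

(* le t is the linear order on the colour class \<rho> t. *)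
definition color_compressed ::
    "nat \<Rightarrow> 'v set \<Rightarrow> 'v set set \<Rightarrow> (nat \<Rightarrow> 'v set) \<Rightarrow> (nat \<Rightarrow> 'v rel) \<Rightarrow> bool" where
  "color_compressed n V \<Delta> \<rho> le \<longleftrightarrow>
     (\<forall>F\<in>\<Delta>. \<forall>t\<in>{1..n}.
        colex_initial_segment (le t) (\<rho> t) (card (F \<inter> \<rho> t))
          {F' \<inter> \<rho> t |F'. F' \<in> \<Delta> \<and> card (F' \<inter> \<rho> t) = card (F \<inter> \<rho> t) \<and>
             F' \<inter> (V - \<rho> t) = F \<inter> (V - \<rho> t)})"

end

theory Submission
  imports Defs
begin

text \<open>
  The direction from color-compressed complexes to arbitrary ones is trivial.  For the other one,
  fix the vertex set with its colour classes, number the vertices, and let the weight of a face be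
  the sum of \<open>2 ^ i\<close> over the numbers \<open>i\<close> of its vertices: inside a colour class, comparing weights
  is comparing in colex order.  Among the complexes with the given colour classes and the given
  fine \<open>f\<close>-vector, one of least total weight is color-compressed.

  Indeed, suppose that it is not.  If \<open>B\<close> is the part in one colour class of some face, and \<open>A\<close> is an
  earlier set in colex order whose exchange for \<open>B\<close> does not give a face, then \<open>U = A - B\<close> and
  \<open>W = B - A\<close> are disjoint sets of equal size inside one colour class with \<open>max U < max W\<close>, and some
  face contains \<open>W\<close> and misses \<open>U\<close>, while exchanging \<open>W\<close> for \<open>U\<close> leads out of the complex.  Choose
  such a pair with \<open>U\<close> as small as possible.  The compression operator exchanges \<open>W\<close> for \<open>U\<close> in
  every face where this produces a new set.  It preserves the number of faces of each colour type
  and lowers the total weight, so the result cannot be a simplicial complex.  But it is one, by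
  lemma \<open>simplicial_complex_compress\<close>, and it is here that the minimality of \<open>U\<close> enters: for
  each \<open>x\<close> in \<open>U\<close> and a suitable \<open>y\<close> in \<open>W\<close>, exchanging \<open>W - {y}\<close> for \<open>U - {x}\<close> stays inside the complex.
  This is the compression proof of the Kruskal-Katona theorem, carried out for all links of the
  complex at the same time.
\<close>

section \<open>Compression of a simplicial complex\<close>

definition exchangeable :: "'v set \<Rightarrow> 'v set \<Rightarrow> 'v set \<Rightarrow> bool" where
  "exchangeable U W F \<longleftrightarrow> W \<subseteq> F \<and> U \<inter> F = {}"

definition exchange :: "'v set \<Rightarrow> 'v set \<Rightarrow> 'v set \<Rightarrow> 'v set" where
  "exchange U W F = (F - W) \<union> U"

definition stable :: "'v set \<Rightarrow> 'v set \<Rightarrow> 'v set set \<Rightarrow> bool" where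
  "stable U W \<Delta> \<longleftrightarrow> (\<forall>F\<in>\<Delta>. exchangeable U W F \<longrightarrow> exchange U W F \<in> \<Delta>)"

text \<open>
  Leaving \<open>F\<close> in place when its exchange is already a face keeps the map injective on \<open>\<Delta>\<close>, so that
  no faces are lost.
\<close>

definition compress_face :: "'v set \<Rightarrow> 'v set \<Rightarrow> 'v set set \<Rightarrow> 'v set \<Rightarrow> 'v set" where
  "compress_face U W \<Delta> F =
     (if exchangeable U W F \<and> exchange U W F \<notin> \<Delta> then exchange U W F else F)"

lemma inj_on_compress_face:
  assumes "U \<inter> W = {}"
  shows "inj_on (compress_face U W \<Delta>) \<Delta>"
proof (rule inj_onI)
  fix F G assume FG: "F \<in> \<Delta>" "G \<in> \<Delta>" and eq: "compress_face U W \<Delta> F = compress_face U W \<Delta> G"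
  have undo: "(exchange U W H - U) \<union> W = H" if "exchangeable U W H" for H
    using that assms by (auto simp: exchange_def exchangeable_def)
  (* The two possible values of the map are told apart by membership in the complex. *)
  have same_case: "exchangeable U W F \<and> exchange U W F \<notin> \<Delta> \<longleftrightarrow>
      exchangeable U W G \<and> exchange U W G \<notin> \<Delta>"
    using eq FG by (metis compress_face_def)
  show "F = G"
  proof (cases "exchangeable U W F \<and> exchange U W F \<notin> \<Delta>")
    case True
    then have "exchange U W F = exchange U W G"
      using eq same_case by (metis compress_face_def)
    then show ?thesis using undo True same_case by metis
  next
    case False
    then show ?thesis using eq same_case by (metis compress_face_def)
  qed
qed

lemma compress_kept:
  assumes "F \<in> \<Delta>" and "exchangeable U W F \<Longrightarrow> exchange U W F \<in> \<Delta>"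
  shows "F \<in> compress_face U W \<Delta> ` \<Delta>"
  using assms by (intro image_eqI[of _ _ F]) (auto simp: compress_face_def)

lemma compress_moved:
  assumes "F \<in> \<Delta>" "exchangeable U W F" "W \<noteq> {}" "U \<inter> W = {}"
  shows "exchange U W F \<in> compress_face U W \<Delta> ` \<Delta>"
proof (cases "exchange U W F \<in> \<Delta>")
  case True
  moreover have "\<not> exchangeable U W (exchange U W F)"
    using assms by (auto simp: exchange_def exchangeable_def)
  ultimately show ?thesis by (intro compress_kept) simp_all
next
  case False
  then show ?thesis using assms by (intro image_eqI[of _ _ F]) (auto simp: compress_face_def)
qed

text \<open>
  Closure under deleting a vertex \<open>x\<close> is only in doubt when \<open>x\<close> lies in \<open>U\<close>, since the deletion
  of a vertex outside \<open>U \<union> W\<close> commutes with the exchange, and an exchanged face contains no vertex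
  of \<open>W\<close>.  For \<open>x\<close> in \<open>U\<close>, exchanging \<open>W - {y}\<close> for \<open>U - {x}\<close> in
  \<open>F - {y}\<close>, which the last hypothesis permits for some \<open>y\<close> in \<open>W\<close>, yields \<open>(F - W) \<union> (U - {x})\<close>, and this
  is the set that is needed.
\<close>

lemma simplicial_complex_compress:
  assumes sc: "simplicial_complex V \<Delta>"
    and UV: "U \<subseteq> V" and W: "W \<noteq> {}" and UW: "U \<inter> W = {}" and card: "card U = card W"
    and smaller: "\<And>x. x \<in> U \<Longrightarrow> \<exists>y\<in>W. stable (U - {x}) (W - {y}) \<Delta>"
  shows "simplicial_complex V (compress_face U W \<Delta> ` \<Delta>)" (is "simplicial_complex V ?C")
proof -
  from sc have fin: "finite V" "V \<noteq> {}" and sub: "\<Delta> \<subseteq> Pow V"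
    and down: "\<And>F G. F \<in> \<Delta> \<Longrightarrow> G \<subseteq> F \<Longrightarrow> G \<in> \<Delta>" and vert: "\<And>v. v \<in> V \<Longrightarrow> {v} \<in> \<Delta>"
    by (auto simp: simplicial_complex_def)
  have exchange_without: "(F - W) \<union> (U - {x}) \<in> \<Delta>"
    if F: "F \<in> \<Delta>" "W \<subseteq> F" "U \<inter> F \<subseteq> {x}" and x: "x \<in> U" for F x
  proof -
    obtain y where y: "y \<in> W" and st: "stable (U - {x}) (W - {y}) \<Delta>"
      using smaller[OF x] by blast
    have "F - {y} \<in> \<Delta>" using down F by blast
    moreover have "exchangeable (U - {x}) (W - {y}) (F - {y})"
      using F by (auto simp: exchangeable_def)
    ultimately have "exchange (U - {x}) (W - {y}) (F - {y}) \<in> \<Delta>"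
      using st by (auto simp: stable_def)
    moreover have "exchange (U - {x}) (W - {y}) (F - {y}) = (F - W) \<union> (U - {x})"
      using y by (auto simp: exchange_def)
    ultimately show ?thesis by simp
  qed
  have moved_diff: "exchange U W F - {x} \<in> ?C" if F: "F \<in> \<Delta>" "exchangeable U W F" for F x
  proof (cases "x \<in> U")
    case True
    have "exchange U W F - {x} = (F - W) \<union> (U - {x})"
      using F True by (auto simp: exchange_def exchangeable_def)
    then have "exchange U W F - {x} \<in> \<Delta>"
      using exchange_without[of F x] F True by (auto simp: exchangeable_def)
    moreover have "\<not> exchangeable U W (exchange U W F - {x})"
      using W UW by (auto simp: exchange_def exchangeable_def)
    ultimately show ?thesis by (intro compress_kept) simp_all
  next
    case False
    (* For x in W the exchange itself removes x, and W must stay inside the set to which it is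
       applied; for this reason x is deleted from F only if it lies outside W. *)
    let ?G = "F - ({x} - W)"
    have "?G \<in> \<Delta>" "exchangeable U W ?G" using down F by (auto simp: exchangeable_def)
    then have "exchange U W ?G \<in> ?C" using compress_moved W UW by blast
    moreover have "exchange U W ?G = exchange U W F - {x}"
      using False by (auto simp: exchange_def)
    ultimately show ?thesis by simp
  qed
  have kept_diff: "F - {x} \<in> ?C"
    if F: "F \<in> \<Delta>" and kept: "exchangeable U W F \<Longrightarrow> exchange U W F \<in> \<Delta>" for F x
  proof (rule compress_kept)
    show "F - {x} \<in> \<Delta>" using down F by blast
    assume ex: "exchangeable U W (F - {x})"
    show "exchange U W (F - {x}) \<in> \<Delta>"
    proof (cases "x \<in> U \<and> x \<in> F")
      case True
      then have "(F - W) \<union> (U - {x}) \<in> \<Delta>"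
        using exchange_without[of F x] F ex by (auto simp: exchangeable_def)
      moreover have "exchange U W (F - {x}) = (F - W) \<union> (U - {x})"
        using True UW by (auto simp: exchange_def)
      ultimately show ?thesis by simp
    next
      case False
      then have "exchange U W F \<in> \<Delta>" using ex kept by (auto simp: exchangeable_def)
      moreover have "exchange U W (F - {x}) \<subseteq> exchange U W F" by (auto simp: exchange_def)
      ultimately show ?thesis using down by blast
    qed
  qed
  have diff: "F - {x} \<in> ?C" if "F \<in> ?C" for F x
  proof -
    obtain H where H: "H \<in> \<Delta>" "F = compress_face U W \<Delta> H"
      using \<open>F \<in> ?C\<close> by blast
    show ?thesis
    proof (cases "exchangeable U W H \<and> exchange U W H \<notin> \<Delta>")
      case True
      then show ?thesis using moved_diff[of H x] H by (simp add: compress_face_def)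
    next
      case False
      then have "F = H" using H by (auto simp: compress_face_def)
      then show ?thesis using kept_diff[of H x] H False by blast
    qed
  qed
  have sub_C: "?C \<subseteq> Pow V"
    using sub UV by (auto simp: compress_face_def exchange_def)
  have down_C: "G \<in> ?C" if "F \<in> ?C" "G \<subseteq> F" for F G
  proof -
    have diff_finite: "F - X \<in> ?C" if "finite X" for X
      using that
    proof (induction X rule: finite_induct)
      case empty
      then show ?case using \<open>F \<in> ?C\<close> by simp
    next
      case (insert x X)
      show ?case by (subst Diff_insert) (rule diff[OF insert.IH])
    qed
    have "F \<subseteq> V" using sub_C that by blast
    then have "finite (F - G)" using fin by (simp add: finite_subset)
    from diff_finite[OF this] show ?thesis using that by (simp add: double_diff)
  qed
  have vert_C: "{v} \<in> ?C" if v: "v \<in> V" for v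
  proof (rule compress_kept)
    show "{v} \<in> \<Delta>" using vert v by blast
    (* A vertex is exchanged only for a vertex, and all vertices are already present. *)
    assume "exchangeable U W {v}"
    then have "W = {v}" using W by (auto simp: exchangeable_def)
    then obtain u where "U = {u}" using card by (auto simp: card_Suc_eq)
    then show "exchange U W {v} \<in> \<Delta>" using vert UV \<open>W = {v}\<close> by (simp add: exchange_def)
  qed
  show ?thesis
    unfolding simplicial_complex_def using fin sub_C down_C vert_C by blast
qed

section \<open>Colours and weights\<close>

lemma card_exchange_Int:
  assumes "finite F" "finite U" "exchangeable U W F" "card (U \<inter> S) = card (W \<inter> S)"
  shows "card (exchange U W F \<inter> S) = card (F \<inter> S)"
proof -
  have W: "W \<subseteq> F" and U: "U \<inter> F = {}" using assms by (auto simp: exchangeable_def)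
  have "exchange U W F \<inter> S = (F \<inter> S - W \<inter> S) \<union> (U \<inter> S)" by (auto simp: exchange_def)
  also have "card \<dots> = card (F \<inter> S - W \<inter> S) + card (W \<inter> S)"
    using assms U by (subst card_Un_disjoint) auto
  also have "\<dots> = card (F \<inter> S)"
  proof -
    have "W \<inter> S \<subseteq> F \<inter> S" using W by blast
    then show ?thesis
      using assms(1) by (simp add: card_Diff_subset card_mono finite_subset)
  qed
  finally show ?thesis .
qed

lemma fine_f_vector_image:
  assumes "inj_on c \<Delta>" and "\<And>F i. F \<in> \<Delta> \<Longrightarrow> i \<in> {1..n} \<Longrightarrow> card (c F \<inter> \<rho> i) = card (F \<inter> \<rho> i)"
    and "is_fine_f_vector n a \<Delta> \<rho> f"
  shows "is_fine_f_vector n a (c ` \<Delta>) \<rho> f"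
proof -
  have "card {F \<in> c ` \<Delta>. \<forall>i\<in>{1..n}. card (F \<inter> \<rho> i) = b i}
      = card {F \<in> \<Delta>. \<forall>i\<in>{1..n}. card (F \<inter> \<rho> i) = b i}" for b
  proof -
    have "{F \<in> c ` \<Delta>. \<forall>i\<in>{1..n}. card (F \<inter> \<rho> i) = b i}
        = c ` {F \<in> \<Delta>. \<forall>i\<in>{1..n}. card (F \<inter> \<rho> i) = b i}"
      using assms(2) by auto
    then show ?thesis
      using assms(1) by (simp add: card_image inj_on_subset)
  qed
  then show ?thesis using assms(3) by (simp add: is_fine_f_vector_def)
qed

definition weight :: "('v \<Rightarrow> nat) \<Rightarrow> 'v set \<Rightarrow> nat" where
  "weight g F = (\<Sum>v\<in>F. 2 ^ g v)"

text \<open>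
  For finite sets this says \<open>max U < max W\<close>.  Naming an element of \<open>W\<close> makes it evident that the
  relation survives the deletion of any other element of \<open>W\<close> and of any element of \<open>U\<close>.
\<close>

definition dominated :: "('v \<Rightarrow> nat) \<Rightarrow> 'v set \<Rightarrow> 'v set \<Rightarrow> bool" where
  "dominated g U W \<longleftrightarrow> (\<exists>w\<in>W. \<forall>u\<in>U. g u < g w)"

text \<open>A power of two exceeds the sum of all smaller powers of two.\<close>

lemma weight_less_if_dominated:
  assumes "finite W" "inj_on g U" "dominated g U W"
  shows "weight g U < weight g W"
proof -
  obtain w where w: "w \<in> W" "\<forall>u\<in>U. g u < g w" using assms by (auto simp: dominated_def)
  have "weight g U = (\<Sum>i\<in>g ` U. 2 ^ i)"
    using assms by (simp add: weight_def sum.reindex)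
  also have "\<dots> \<le> (\<Sum>i<g w. 2 ^ i)" using w by (intro sum_mono2) auto
  also have "\<dots> < 2 ^ g w" by (simp add: lessThan_atLeast0 sum_power2)
  also have "\<dots> \<le> weight g W"
    unfolding weight_def by (rule member_le_sum) (use w assms in auto)
  finally show ?thesis .
qed

lemma weight_exchange_less:
  assumes "finite F" "finite U" "exchangeable U W F" "weight g U < weight g W"
  shows "weight g (exchange U W F) < weight g F"
proof -
  have W: "W \<subseteq> F" and U: "U \<inter> F = {}" using assms by (auto simp: exchangeable_def)
  have "weight g (exchange U W F) = weight g (F - W) + weight g U"
    unfolding weight_def exchange_def using assms U by (intro sum.union_disjoint) auto
  also have "\<dots> < weight g (F - W) + weight g W" using assms by simp
  also have "\<dots> = weight g F"
    unfolding weight_def using W assms by (simp add: sum.subset_diff)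
  finally show ?thesis .
qed

section \<open>Complexes of least weight\<close>

text \<open>
  The exchanges of smaller pairs are needed to keep the compressed family a complex.  The pair
  \<open>U - {x}\<close>, \<open>W - {y}\<close> is again dominated as soon as \<open>y\<close> differs from a dominating element of \<open>W\<close>;
  if \<open>W\<close> has no other element, both sets become empty and their exchange is the identity.
\<close>

lemma lighter_colored_complex:
  assumes cc: "colored_complex n a V \<Delta> \<rho>" and fv: "is_fine_f_vector n a \<Delta> \<rho> f"
    and g: "inj_on g V" and t: "t \<in> {1..n}"
    and UW: "U \<subseteq> \<rho> t" "W \<subseteq> \<rho> t" "U \<inter> W = {}" "card U = card W" "dominated g U W"
    and unstable: "\<not> stable U W \<Delta>"
    and smaller: "\<And>U' W'. U' \<subseteq> \<rho> t \<Longrightarrow> W' \<subseteq> \<rho> t \<Longrightarrow> U' \<inter> W' = {} \<Longrightarrow> card U' = card W' \<Longrightarrow>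
       dominated g U' W' \<Longrightarrow> card U' < card U \<Longrightarrow> stable U' W' \<Delta>"
  shows "\<exists>\<Delta>'. colored_complex n a V \<Delta>' \<rho> \<and> is_fine_f_vector n a \<Delta>' \<rho> f \<and>
    sum (weight g) \<Delta>' < sum (weight g) \<Delta>"
proof -
  let ?c = "compress_face U W \<Delta>"
  from cc have sc: "simplicial_complex V \<Delta>" and op: "ordered_partition n V \<rho>"
    and bound: "\<And>F i. F \<in> \<Delta> \<Longrightarrow> i \<in> {1..n} \<Longrightarrow> card (F \<inter> \<rho> i) \<le> a i"
    by (auto simp: colored_complex_def)
  from sc have finV: "finite V" and sub: "\<Delta> \<subseteq> Pow V" by (auto simp: simplicial_complex_def)
  have rho_sub: "\<rho> t \<subseteq> V" using op t by (auto simp: ordered_partition_def)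
  have finU: "finite U" and finW: "finite W"
    using UW(1,2) finite_subset[OF rho_sub finV] by (simp_all add: finite_subset)
  have fin: "finite F" if "F \<in> \<Delta>" for F using that sub finV finite_subset by blast
  have finD: "finite \<Delta>" using sub finV by (simp add: finite_subset)
  have W_ne: "W \<noteq> {}" using UW by (auto simp: dominated_def)
  have "\<exists>y\<in>W. stable (U - {x}) (W - {y}) \<Delta>" if x: "x \<in> U" for x
  proof -
    obtain w where w: "w \<in> W" "\<forall>u\<in>U. g u < g w" using UW by (auto simp: dominated_def)
    show ?thesis
    proof (cases "W = {w}")
      case True
      then have "card U = 1" using UW by simp
      then obtain u where "U = {u}" by (rule card_1_singletonE)
      then have "U = {x}" using x by simp
      then show ?thesis
        using True by (auto simp: stable_def exchange_def)
    next
      case False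
      then obtain y where y: "y \<in> W" "y \<noteq> w" using w by blast
      have "stable (U - {x}) (W - {y}) \<Delta>"
      proof (rule smaller)
        show "dominated g (U - {x}) (W - {y})" using w y by (auto simp: dominated_def)
        show "card (U - {x}) = card (W - {y})" using UW x y by simp
        show "card (U - {x}) < card U" using x finU by (rule card_Diff1_less[rotated])
      qed (use UW in auto)
      then show ?thesis using y by blast
    qed
  qed
  then have sc': "simplicial_complex V (?c ` \<Delta>)"
    by (intro simplicial_complex_compress[OF sc order_trans[OF UW(1) rho_sub] W_ne UW(3,4)])
  have colour: "card (?c F \<inter> \<rho> i) = card (F \<inter> \<rho> i)" if "F \<in> \<Delta>" "i \<in> {1..n}" for F i
  proof -
    have "card (U \<inter> \<rho> i) = card (W \<inter> \<rho> i)"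
    proof (cases "i = t")
      case True
      then show ?thesis using UW by (simp add: Int_absorb2)
    next
      case False
      then have "\<rho> t \<inter> \<rho> i = {}"
        using op t that by (auto simp: ordered_partition_def disjoint_family_on_def)
      then have "U \<inter> \<rho> i = {}" "W \<inter> \<rho> i = {}" using UW by auto
      then show ?thesis by simp
    qed
    then show ?thesis
      using card_exchange_Int[OF fin finU] that by (auto simp: compress_face_def)
  qed
  have inj: "inj_on ?c \<Delta>" using UW(3) by (rule inj_on_compress_face)
  have "colored_complex n a V (?c ` \<Delta>) \<rho>"
    unfolding colored_complex_def
  proof (intro conjI ballI sc' op)
    fix F i assume "F \<in> ?c ` \<Delta>" "i \<in> {1..n}"
    then show "card (F \<inter> \<rho> i) \<le> a i" using bound colour by fastforce
  qed
  moreover have "is_fine_f_vector n a (?c ` \<Delta>) \<rho> f"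
    by (rule fine_f_vector_image[OF inj colour fv])
  moreover have "sum (weight g) (?c ` \<Delta>) < sum (weight g) \<Delta>"
  proof -
    have "weight g U < weight g W"
      using UW rho_sub by (intro weight_less_if_dominated finW inj_on_subset[OF g]) auto
    then have less: "weight g (exchange U W F) < weight g F" if "F \<in> \<Delta>" "exchangeable U W F" for F
      using weight_exchange_less[OF fin finU] that by blast
    have "sum (weight g) (?c ` \<Delta>) = (\<Sum>F\<in>\<Delta>. weight g (?c F))"
      using inj by (simp add: sum.reindex)
    also have "\<dots> < sum (weight g) \<Delta>"
    proof (rule sum_strict_mono_ex1[OF finD])
      show "\<forall>F\<in>\<Delta>. weight g (?c F) \<le> weight g F"
        using less by (auto simp: compress_face_def less_imp_le)
      show "\<exists>F\<in>\<Delta>. weight g (?c F) < weight g F"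
        using unstable less by (auto simp: compress_face_def stable_def)
    qed
    finally show ?thesis .
  qed
  ultimately show ?thesis by blast
qed

lemma stable_if_least_weight:
  assumes cc: "colored_complex n a V \<Delta> \<rho>" and fv: "is_fine_f_vector n a \<Delta> \<rho> f"
    and g: "inj_on g V" and t: "t \<in> {1..n}"
    and least: "\<And>\<Delta>'. colored_complex n a V \<Delta>' \<rho> \<Longrightarrow> is_fine_f_vector n a \<Delta>' \<rho> f \<Longrightarrow>
       sum (weight g) \<Delta> \<le> sum (weight g) \<Delta>'"
    and UW: "U \<subseteq> \<rho> t" "W \<subseteq> \<rho> t" "U \<inter> W = {}" "card U = card W" "dominated g U W"
  shows "stable U W \<Delta>"
  using UW
proof (induction "card U" arbitrary: U W rule: less_induct)
  case less
  show ?case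
  proof (rule ccontr)
    assume "\<not> stable U W \<Delta>"
    then obtain \<Delta>' where "colored_complex n a V \<Delta>' \<rho>" "is_fine_f_vector n a \<Delta>' \<rho> f"
        "sum (weight g) \<Delta>' < sum (weight g) \<Delta>"
      using lighter_colored_complex[OF cc fv g t less.prems] less.hyps by blast
    then show False using least by (simp add: leD)
  qed
qed

section \<open>Colex order and stability\<close>

definition order_by :: "('v \<Rightarrow> nat) \<Rightarrow> 'v set \<Rightarrow> 'v rel" where
  "order_by g S = {(x, y). x \<in> S \<and> y \<in> S \<and> g x \<le> g y}"

lemma linear_order_on_order_by:
  assumes "inj_on g S"
  shows "linear_order_on S (order_by g S)"
proof -
  have "antisym (order_by g S)"
    using inj_onD[OF assms] by (auto simp: order_by_def intro!: antisymI)
  then show ?thesis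
    unfolding linear_order_on_def partial_order_on_def preorder_on_def
    by (auto simp: order_by_def refl_on_def trans_def total_on_def)
qed

lemma max_wrt_order_by:
  assumes "finite A" "A \<noteq> {}" "A \<subseteq> S" "inj_on g S"
  shows "max_wrt (order_by g S) A \<in> A \<and> (\<forall>y\<in>A. g y \<le> g (max_wrt (order_by g S) A))"
proof -
  have "Max (g ` A) \<in> g ` A" using assms by simp
  then obtain m where m: "m \<in> A" "g m = Max (g ` A)" by auto
  then have m_max: "\<forall>y\<in>A. g y \<le> g m" using assms by simp
  have "max_wrt (order_by g S) A = m"
    unfolding max_wrt_def
  proof (rule the_equality)
    show "m \<in> A \<and> (\<forall>y\<in>A. (y, m) \<in> order_by g S)"
      using m m_max assms by (auto simp: order_by_def)
    fix x assume "x \<in> A \<and> (\<forall>y\<in>A. (y, x) \<in> order_by g S)"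
    then show "x = m"
      using m m_max assms by (auto simp: order_by_def intro!: inj_onD[OF assms(4)] le_antisym)
  qed
  then show ?thesis using m m_max by simp
qed

lemma dominated_if_colex_less:
  assumes "finite S" "inj_on g S" "A \<subseteq> S" "B \<subseteq> S" "card A = card B"
    and less: "colex_less (order_by g S) A B"
  shows "dominated g (A - B) (B - A)"
proof -
  have fin: "finite A" "finite B" using assms finite_subset by blast+
  have "A \<noteq> B" using less by (simp add: colex_less_def)
  then have ne: "A - B \<noteq> {}" "B - A \<noteq> {}"
    using fin assms(5) card_subset_eq[of A B] card_subset_eq[of B A] by auto
  let ?a = "max_wrt (order_by g S) (A - B)" and ?b = "max_wrt (order_by g S) (B - A)"
  have a: "\<forall>y\<in>A - B. g y \<le> g ?a" and aA: "?a \<in> A - B"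
    using max_wrt_order_by[of "A - B" S g] fin ne assms by blast+
  have b: "?b \<in> B - A"
    using max_wrt_order_by[of "B - A" S g] fin ne assms by blast
  have "g ?a \<le> g ?b" "?a \<noteq> ?b" using less by (auto simp: colex_less_def order_by_def)
  then have "g ?a < g ?b" using inj_onD[OF assms(2), of ?a ?b] aA b assms by force
  then show ?thesis unfolding dominated_def using a b by (blast intro: le_less_trans)
qed

text \<open>
  For a face \<open>F'\<close> with \<open>F' \<inter> \<rho> t = B\<close>, exchanging \<open>B - A\<close> for \<open>A - B\<close> replaces \<open>B\<close> by \<open>A\<close> and does not
  affect the other colours, so stability carries a colex-smaller \<open>A\<close> into the same link.
\<close>

lemma color_compressed_if_stable:
  assumes cc: "colored_complex n a V \<Delta> \<rho>" and g: "inj_on g V"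
    and st: "\<And>t U W. t \<in> {1..n} \<Longrightarrow> U \<subseteq> \<rho> t \<Longrightarrow> W \<subseteq> \<rho> t \<Longrightarrow> U \<inter> W = {} \<Longrightarrow> card U = card W \<Longrightarrow>
       dominated g U W \<Longrightarrow> stable U W \<Delta>"
  shows "color_compressed n V \<Delta> \<rho> (\<lambda>i. order_by g (\<rho> i))"
  unfolding color_compressed_def
proof (intro ballI)
  fix F t assume "F \<in> \<Delta>" and t: "t \<in> {1..n}"
  let ?k = "card (F \<inter> \<rho> t)"
  let ?A = "{F' \<inter> \<rho> t |F'. F' \<in> \<Delta> \<and> card (F' \<inter> \<rho> t) = ?k \<and> F' \<inter> (V - \<rho> t) = F \<inter> (V - \<rho> t)}"
  have rho_sub: "\<rho> t \<subseteq> V" and finV: "finite V"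
    using cc t by (auto simp: colored_complex_def ordered_partition_def simplicial_complex_def)
  then have fin: "finite (\<rho> t)" using finite_subset by blast
  have "A \<in> ?A"
    if B: "B \<in> ?A" and A: "A \<in> [\<rho> t]\<^bsup>?k\<^esup>" and less: "colex_less (order_by g (\<rho> t)) A B" for A B
  proof -
    obtain F' where F': "F' \<in> \<Delta>" "B = F' \<inter> \<rho> t" "card B = ?k" "F' \<inter> (V - \<rho> t) = F \<inter> (V - \<rho> t)"
      using B by blast
    have A_props: "A \<subseteq> \<rho> t" "card A = ?k" using A by (auto simp: nsets_def)
    have B_sub: "B \<subseteq> \<rho> t" using F' by blast
    have "dominated g (A - B) (B - A)"
      using dominated_if_colex_less[OF fin _ A_props(1) B_sub _ less] A_props F' g rho_sub
      by (simp add: inj_on_subset)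
    moreover have "card (A - B) = card (B - A)"
      using A_props F'(3) B_sub fin
      by (simp add: card_Diff_subset_Int finite_subset Int_commute)
    ultimately have "stable (A - B) (B - A) \<Delta>"
      using A_props B_sub by (intro st[OF t]) auto
    moreover have "exchangeable (A - B) (B - A) F'"
      using F' A_props by (auto simp: exchangeable_def)
    ultimately have face: "exchange (A - B) (B - A) F' \<in> \<Delta>" (is "?F \<in> \<Delta>")
      using F' by (simp add: stable_def)
    have inter: "?F \<inter> \<rho> t = A" using F' A_props by (auto simp: exchange_def)
    have "?F \<inter> (V - \<rho> t) = F' \<inter> (V - \<rho> t)"
      using F' A_props by (auto simp: exchange_def)
    then have "A = ?F \<inter> \<rho> t \<and> ?F \<in> \<Delta> \<and> card (?F \<inter> \<rho> t) = ?k \<and> ?F \<inter> (V - \<rho> t) = F \<inter> (V - \<rho> t)"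
      using face inter A_props F'(4) by simp
    then show ?thesis by blast
  qed
  moreover have "?A \<subseteq> [\<rho> t]\<^bsup>?k\<^esup>" using fin by (auto simp: nsets_def)
  ultimately show "colex_initial_segment (order_by g (\<rho> t)) (\<rho> t) ?k ?A"
    unfolding colex_initial_segment_def by blast
qed

section \<open>Fine f-vectors of color-compressed complexes\<close>

theorem corollary3p4:
  fixes n :: nat and a :: "nat \<Rightarrow> nat" and f :: "(nat \<Rightarrow> nat) \<Rightarrow> int"
  assumes "n \<ge> 1" and "\<forall>i\<in>{1..n}. a i \<ge> 1"
  shows "(\<exists>(V :: 'v::infinite set) \<Delta> \<rho>.
            colored_complex n a V \<Delta> \<rho> \<and> is_fine_f_vector n a \<Delta> \<rho> f)
     \<longleftrightarrow> (\<exists>(V :: 'v set) \<Delta> \<rho> le.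
            colored_complex n a V \<Delta> \<rho> \<and> (\<forall>i\<in>{1..n}. linear_order_on (\<rho> i) (le i)) \<and>
            color_compressed n V \<Delta> \<rho> le \<and> is_fine_f_vector n a \<Delta> \<rho> f)"
    (is "?any \<longleftrightarrow> ?compressed")
proof
  assume ?any
  then obtain V :: "'v set" and \<Delta>\<^sub>0 \<rho>
    where start: "colored_complex n a V \<Delta>\<^sub>0 \<rho> \<and> is_fine_f_vector n a \<Delta>\<^sub>0 \<rho> f" by blast
  then have "finite V" by (simp add: colored_complex_def simplicial_complex_def)
  then obtain g :: "'v \<Rightarrow> nat" where g: "inj_on g V"
    by (auto dest: finite_imp_inj_to_nat_seg)
  obtain \<Delta> where cc: "colored_complex n a V \<Delta> \<rho>" and fv: "is_fine_f_vector n a \<Delta> \<rho> f"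
    and least: "\<And>\<Delta>'. colored_complex n a V \<Delta>' \<rho> \<Longrightarrow> is_fine_f_vector n a \<Delta>' \<rho> f \<Longrightarrow>
       sum (weight g) \<Delta> \<le> sum (weight g) \<Delta>'"
    using ex_has_least_nat[of "\<lambda>\<Delta>. colored_complex n a V \<Delta> \<rho> \<and> is_fine_f_vector n a \<Delta> \<rho> f",
        OF start, of "sum (weight g)"] by blast
  have "color_compressed n V \<Delta> \<rho> (\<lambda>i. order_by g (\<rho> i))"
    using color_compressed_if_stable[OF cc g] stable_if_least_weight[OF cc fv g _ least] by blast
  moreover have "linear_order_on (\<rho> i) (order_by g (\<rho> i))" if "i \<in> {1..n}" for i
  proof (rule linear_order_on_order_by)
    have "\<rho> i \<subseteq> V" using cc that by (auto simp: colored_complex_def ordered_partition_def)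
    then show "inj_on g (\<rho> i)" using g inj_on_subset by blast
  qed
  ultimately show ?compressed
    using cc fv
    by (intro exI[of _ V] exI[of _ \<Delta>] exI[of _ \<rho>] exI[of _ "\<lambda>i. order_by g (\<rho> i)"]) simp
next
  assume ?compressed
  then show ?any by blast
qed

end
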